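(* Let $F$ be an infinite field and let $d \in \mathbb{N}$. For every $n \in \mathbb{N}$ and every nonzero multilinear polynomial $f \in F\langle X_1,\ldots,X_n\rangle$ there exists an $s \in \mathbb{N}$ such that $\mathrm{sl}_d(F) \subseteq f(M_s(F))$.
   Context: $\mathbb{N}$ denotes the positive integers. $F\langle X_1,\ldots,X_n\rangle$ is the free associative unital $F$-algebra in $X_1,\ldots,X_n$. A polynomial $f \in F\langle X_1,\ldots,X_n\rangle$ is multilinear if it has the form $f = \sum_{\sigma \in S_n} \lambda_\sigma X_{\sigma(1)} \cdots X_{\sigma(n)}$ with $\lambda_\sigma \in F$. For an $F$-algebra $A$, the image of $f$ in $A$ is $f(A) = \{f(a_1,\ldots,a_n) \mid a_1,\ldots,a_n \in A\}$. $\mathrm{sl}_d(F)$ denotes the space of all trace zero matrices in $M_d(F)$. For $s \ge d$, $M_d(F)$ is regarded as a subset of $M_s(F)$ via the (non-unital) upper-left corner embedding $a \mapsto \begin{pmatrix} a & 0 \\ 0 & 0\end{pmatrix}$; the inclusion $\mathrm{sl}_d(F) \subseteq f(M_s(F))$ is understood with $s \geq d$ and through this embedding. *)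

theory Defs
  imports
    "HOL-Library.Poly_Mapping"
    "HOL-Combinatorics.Permutations"
    "Jordan_Normal_Form.Matrix"
begin

section \<open>The free algebra\<close>

text \<open>
  Words in the letters \<open>X\<^sub>i\<close> (\<open>i :: nat\<close>) form the free monoid. It is written additively,
  because that is how \<^theory>\<open>HOL-Library.Poly_Mapping\<close> builds monoid algebras: the product on
  \<open>word \<Rightarrow>\<^sub>0 'a\<close> is then the convolution product extending concatenation, and \<open>word \<Rightarrow>\<^sub>0 'a\<close> is
  the free associative unital algebra in countably many variables.
\<close>

datatype word = Word (letters: "nat list")

instantiation word :: monoid_add
begin

definition zero_word :: word where "0 = Word []"

definition plus_word :: "word \<Rightarrow> word \<Rightarrow> word"
  where "u + v = Word (letters u @ letters v)"

instance
  by standard (simp_all add: zero_word_def plus_word_def)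

end

type_synonym 'a free_poly = "word \<Rightarrow>\<^sub>0 'a"

definition Var :: "nat \<Rightarrow> 'a::comm_ring_1 free_poly"
  where "Var i = Poly_Mapping.single (Word [i]) 1"

definition Const :: "'a::comm_ring_1 \<Rightarrow> 'a free_poly"
  where "Const c = Poly_Mapping.single 0 c"

text \<open>The subalgebra \<open>F\<langle>X\<^sub>1,\<dots>,X\<^sub>n\<rangle>\<close>.\<close>

definition free_algebra :: "nat \<Rightarrow> 'a::comm_ring_1 free_poly set"
  where "free_algebra n = {f. \<forall>w \<in> Poly_Mapping.keys f. set (letters w) \<subseteq> {1..n}}"

definition multilinear :: "nat \<Rightarrow> 'a::comm_ring_1 free_poly \<Rightarrow> bool"
  where "multilinear n f \<longleftrightarrow>
    (\<exists>c :: (nat \<Rightarrow> nat) \<Rightarrow> 'a.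
      f = (\<Sum>\<sigma> | \<sigma> permutes {1..n}. Const (c \<sigma>) * (\<Prod>i\<leftarrow>[1..<Suc n]. Var (\<sigma> i))))"

section \<open>Evaluation in an algebra\<close>

text \<open>
  Algebras are given as module records, whose ring part carries the multiplication. (The locale
  \<^locale>\<open>algebra\<close> of HOL-Algebra is of no use here, as it requires commutativity.)
\<close>

definition eval_word :: "('a, 'b, 'm) module_scheme \<Rightarrow> (nat \<Rightarrow> 'b) \<Rightarrow> word \<Rightarrow> 'b"
  where "eval_word A a w = foldr (\<lambda>i x. a i \<otimes>\<^bsub>A\<^esub> x) (letters w) \<one>\<^bsub>A\<^esub>"

definition eval_poly ::
    "('a::comm_ring_1, 'b, 'm) module_scheme \<Rightarrow> (nat \<Rightarrow> 'b) \<Rightarrow> 'a free_poly \<Rightarrow> 'b"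
  where "eval_poly A a f =
    (\<Oplus>\<^bsub>A\<^esub>w \<in> Poly_Mapping.keys f. Poly_Mapping.lookup f w \<odot>\<^bsub>A\<^esub> eval_word A a w)"

definition poly_image ::
    "nat \<Rightarrow> 'a::comm_ring_1 free_poly \<Rightarrow> ('a, 'b, 'm) module_scheme \<Rightarrow> 'b set"
  where "poly_image n f A = {eval_poly A a f |a. \<forall>i \<in> {1..n}. a i \<in> carrier A}"

section \<open>Matrices\<close>

abbreviation mat_algebra :: "nat \<Rightarrow> ('a::comm_ring_1, 'a mat) module"
  where "mat_algebra s \<equiv> module_mat TYPE('a) s s"

definition mat_trace :: "'a::comm_monoid_add mat \<Rightarrow> 'a"
  where "mat_trace A = (\<Sum>i<dim_row A. A $$ (i, i))"

definition sl :: "nat \<Rightarrow> 'a::comm_monoid_add mat set"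
  where "sl d = {A \<in> carrier_mat d d. mat_trace A = 0}"

definition corner_embed :: "nat \<Rightarrow> nat \<Rightarrow> 'a::zero mat \<Rightarrow> 'a mat"
  where "corner_embed d s A =
    four_block_mat A (0\<^sub>m d (s - d)) (0\<^sub>m (s - d) d) (0\<^sub>m (s - d) (s - d))"

end

theory Submission
  imports Defs "Jordan_Normal_Form.Determinant" "HOL-Library.Nat_Bijection" "HOL-Number_Theory.Cong"
begin

text \<open>
  Let \<open>\<sigma>\<^sub>0\<close> be a permutation with nonzero coefficient and single out the letter \<open>l\<^sub>0 = \<sigma>\<^sub>0 1\<close>.
  Index the rows of a \<open>D n \<times> D n\<close> matrix by pairs \<open>(i, p)\<close> with \<open>i < D\<close> and \<open>p \<in> \<int>/n\<close>. Every
  \<open>x\<^sub>l\<close> moves \<open>p\<close> to \<open>p + 1\<close>; for \<open>l \<noteq> l\<^sub>0\<close> it fixes \<open>i\<close> and has the weight \<open>t\<^sub>i w\<^sub>l(p)\<close>, while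
  \<open>x\<^bsub>l\<^sub>0\<^esub>\<close> takes \<open>(i, p)\<close> to \<open>(j, p + 1)\<close> with a free coefficient \<open>z\<^sub>i\<^sub>j(p)\<close>. Then the entry of
  \<open>f(x)\<close> at \<open>((i, p), (j, p))\<close> is \<open>\<Sum>\<^sub>r M(p, r) z\<^sub>i\<^sub>j(r)\<close>, where, up to a power of \<open>t\<^sub>j\<close>, the matrix \<open>M\<close>
  is polynomial in \<open>t\<^sub>i/t\<^sub>j\<close>. At \<open>0\<close> it is diagonal, and with the weights \<open>w\<^sub>l(p)\<close> taken as powers
  of a generic \<open>\<tau>\<close> with exponents that separate permutations its diagonal entries are nonzero. So
  over an infinite field the \<open>t\<^sub>i\<close> can be chosen such that all these linear systems with \<open>i \<noteq> j\<close>
  are solvable. Hence every matrix which is supported on the entries \<open>((i, p), (j, p))\<close> with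
  \<open>i \<noteq> j\<close> is a value of \<open>f\<close>.

  It remains to conjugate \<open>A \<oplus> 0\<close>, for \<open>A\<close> of trace zero, to such a matrix. For a row
  vector \<open>z = x A\<close> and a column vector \<open>y\<close> with \<open>z y = 0\<close>, the matrix \<open>A \<oplus> 0\<close> is similar to the
  block matrix with rows \<open>(A + y z, - A y)\<close> and \<open>(z, 0)\<close>. For generic \<open>x\<close> the equations
  \<open>y\<^sub>i z\<^sub>i = - A\<^sub>i\<^sub>i\<close> are solvable and make the diagonal vanish; they imply \<open>z y = - tr A = 0\<close>.
\<close>

section \<open>Evaluation in matrix algebras\<close>

text \<open>\<open>eval_poly\<close> sums with \<open>finsum\<close> of a module record. These facts
  reduce that sum to entries and let a two-sided product pass through it.\<close>

lemma finsum_mat_props: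
  fixes m :: "'w \<Rightarrow> 'a::comm_ring_1 mat"
  assumes "finite W" and m: "\<And>w. w \<in> W \<Longrightarrow> m w \<in> carrier_mat s s"
  shows finsum_mat_closed: "finsum (mat_algebra s) m W \<in> carrier_mat s s"
    and index_finsum_mat: "a < s \<Longrightarrow> b < s \<Longrightarrow>
      finsum (mat_algebra s) m W $$ (a, b) = (\<Sum>w\<in>W. m w $$ (a, b))"
    and mult_finsum_mat: "P \<in> carrier_mat s s \<Longrightarrow> Q \<in> carrier_mat s s \<Longrightarrow>
      Q * finsum (mat_algebra s) m W * P = finsum (mat_algebra s) (\<lambda>w. Q * m w * P) W"
proof -
  interpret abelian_group "mat_algebra s :: ('a, 'a mat) module"
    by (rule abelian_group_mat)
  note simps = finsum_empty finsum_insert Pi_iff module_mat_simps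
  show closed: "finsum (mat_algebra s) m W \<in> carrier_mat s s"
    using finsum_closed[of m W] m by (simp add: Pi_iff module_mat_simps)
  show "finsum (mat_algebra s) m W $$ (a, b) = (\<Sum>w\<in>W. m w $$ (a, b))"
    if "a < s" "b < s"
    using assms
  proof (induction W)
    case (insert w W)
    have "finsum (mat_algebra s) m W \<in> carrier_mat s s"
      using finsum_closed[of m W] insert.prems by (simp add: Pi_iff module_mat_simps)
    with insert that show ?case by (simp add: simps)
  qed (use that in \<open>simp add: simps\<close>)
  show "Q * finsum (mat_algebra s) m W * P = finsum (mat_algebra s) (\<lambda>w. Q * m w * P) W"
    if "P \<in> carrier_mat s s" "Q \<in> carrier_mat s s"
    using assms
  proof (induction W)
    case (insert w W)
    have "finsum (mat_algebra s) m W \<in> carrier_mat s s"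
      using finsum_closed[of m W] insert.prems by (simp add: Pi_iff module_mat_simps)
    moreover have "Q * m v * P \<in> carrier_mat s s" if "v \<in> insert w W" for v
      using insert.prems(1)[OF that] \<open>P \<in> _\<close> \<open>Q \<in> _\<close> by simp
    ultimately show ?case using insert that
      by (simp add: simps mult_add_distrib_mat[of _ s s _ s] add_mult_distrib_mat[of _ s s _ _ s])
  qed (use that in \<open>simp add: simps\<close>)
qed

lemma eval_word_Nil [simp]: "eval_word (mat_algebra s) x (Word []) = 1\<^sub>m s"
  by (simp add: eval_word_def module_mat_simps)

lemma eval_word_Cons [simp]:
  "eval_word (mat_algebra s) x (Word (l # ls)) = x l * eval_word (mat_algebra s) x (Word ls)"
  by (simp add: eval_word_def module_mat_simps)

lemma eval_word_closed:
  assumes "\<And>l. x l \<in> carrier_mat s s"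
  shows "eval_word (mat_algebra s) x w \<in> carrier_mat s s"
proof (cases w)
  case (Word ls)
  have "eval_word (mat_algebra s) x (Word ls) \<in> carrier_mat s s"
    using assms by (induction ls) (auto intro: mult_carrier_mat[of _ s s])
  then show ?thesis using Word by simp
qed

text \<open>The inner factors \<open>P * Q\<close> cancel between neighbouring letters; the empty
  word is where \<open>Q * P\<close> has to be the identity.\<close>

lemma eval_word_conj:
  assumes x: "\<And>l. x l \<in> carrier_mat s s"
    and P: "P \<in> carrier_mat s s" and Q: "Q \<in> carrier_mat s s"
    and PQ: "P * Q = 1\<^sub>m s" and QP: "Q * P = 1\<^sub>m s"
  shows "eval_word (mat_algebra s) (\<lambda>l. Q * x l * P) w = Q * eval_word (mat_algebra s) x w * P"
proof (cases w)
  case (Word ls)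
  have "eval_word (mat_algebra s) (\<lambda>l. Q * x l * P) (Word ls)
      = Q * eval_word (mat_algebra s) x (Word ls) * P"
  proof (induction ls)
    case (Cons l ls)
    let ?E = "eval_word (mat_algebra s) x (Word ls)"
    have E: "?E \<in> carrier_mat s s" using x by (rule eval_word_closed)
    have "Q * x l * P * (Q * ?E * P) = Q * x l * (P * Q) * ?E * P"
      using x[of l] P Q E by (simp add: assoc_mult_mat[of _ s s _ s _ s] del: PQ)
    also have "\<dots> = Q * (x l * ?E) * P"
      using x[of l] P Q E by (simp add: PQ assoc_mult_mat[of _ s s _ s _ s])
    finally show ?case by (simp add: Cons.IH)
  qed (use P Q QP in simp)
  then show ?thesis using Word by simp
qed

lemma eval_poly_closed:
  assumes "\<And>l. x l \<in> carrier_mat s s"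
  shows "eval_poly (mat_algebra s) x f \<in> carrier_mat s s"
  unfolding eval_poly_def module_mat_simps
  by (intro finsum_mat_closed smult_carrier_mat eval_word_closed assms) simp

text \<open>Values of a polynomial are closed under conjugation, so a target matrix may be replaced
  by a similar one of convenient shape.\<close>

lemma eval_poly_conj:
  assumes x: "\<And>l. x l \<in> carrier_mat s s"
    and P: "P \<in> carrier_mat s s" and Q: "Q \<in> carrier_mat s s"
    and PQ: "P * Q = 1\<^sub>m s" and QP: "Q * P = 1\<^sub>m s"
  shows "eval_poly (mat_algebra s) (\<lambda>l. Q * x l * P) f = Q * eval_poly (mat_algebra s) x f * P"
proof -
  have E: "eval_word (mat_algebra s) x w \<in> carrier_mat s s" for w
    using x by (rule eval_word_closed)
  show ?thesis
    unfolding eval_poly_def module_mat_simps eval_word_conj[OF assms]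
    using E P Q
    by (subst mult_finsum_mat)
      (simp_all add: mult_smult_distrib[of _ s s _ s] mult_smult_assoc_mat[of _ s s _ s])
qed

section \<open>Entries of the value of a multilinear polynomial\<close>

lemma Const_mult_Var_prod:
  "Const c * (\<Prod>i\<leftarrow>is. Var (\<sigma> i)) = Poly_Mapping.single (Word (map \<sigma> is)) c"
proof -
  have "(\<Prod>i\<leftarrow>is. Var (\<sigma> i)) = (Poly_Mapping.single (Word (map \<sigma> is)) 1 :: 'a free_poly)"
    by (induction "is")
      (simp_all add: Var_def mult_single plus_word_def flip: single_one zero_word_def)
  then show ?thesis
    by (simp add: Const_def mult_single zero_word_def plus_word_def)
qed

lemma sum_keys_superset:
  assumes "finite W" "Poly_Mapping.keys f \<subseteq> W"
  shows "(\<Sum>w\<in>Poly_Mapping.keys f. Poly_Mapping.lookup f w * h w)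
    = (\<Sum>w\<in>W. Poly_Mapping.lookup f w * (h w :: 'a::comm_ring_1))"
  using assms by (intro sum.mono_neutral_left) (auto simp: in_keys_iff)

lemma sum_keys_add:
  "(\<Sum>w\<in>Poly_Mapping.keys (f + g). Poly_Mapping.lookup (f + g) w * (h w :: 'a::comm_ring_1))
    = (\<Sum>w\<in>Poly_Mapping.keys f. Poly_Mapping.lookup f w * h w)
      + (\<Sum>w\<in>Poly_Mapping.keys g. Poly_Mapping.lookup g w * h w)"
proof -
  \<comment> \<open>Coefficients of \<open>f\<close> and \<open>g\<close> may cancel in
    \<open>f + g\<close>, so all three sums are first extended by zeros to a common index
    set.\<close>
  let ?W = "Poly_Mapping.keys f \<union> Poly_Mapping.keys g"
  have fin: "finite ?W" by simp
  show ?thesis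
    unfolding sum_keys_superset[OF fin Poly_Mapping.keys_add]
      sum_keys_superset[OF fin Un_upper1] sum_keys_superset[OF fin Un_upper2]
    by (simp add: lookup_add distrib_right sum.distrib)
qed

lemma sum_keys_sum_single:
  assumes "finite S"
  shows "(\<Sum>w\<in>Poly_Mapping.keys (\<Sum>\<sigma>\<in>S. Poly_Mapping.single (u \<sigma>) (c \<sigma>)).
      Poly_Mapping.lookup (\<Sum>\<sigma>\<in>S. Poly_Mapping.single (u \<sigma>) (c \<sigma>)) w * (h w :: 'a::comm_ring_1))
    = (\<Sum>\<sigma>\<in>S. c \<sigma> * h (u \<sigma>))"
  using assms
proof (induction S)
  case (insert \<sigma> S)
  show ?case
    using insert by (simp add: sum_keys_add del: lookup_add)
qed simp

lemma index_eval_multilinear: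
  fixes c :: "(nat \<Rightarrow> nat) \<Rightarrow> 'a::comm_ring_1"
  assumes x: "\<And>l. x l \<in> carrier_mat s s" and "a < s" "b < s"
  shows "eval_poly (mat_algebra s) x
      (\<Sum>\<sigma> | \<sigma> permutes {1..n}. Const (c \<sigma>) * (\<Prod>i\<leftarrow>[1..<Suc n]. Var (\<sigma> i))) $$ (a, b)
    = (\<Sum>\<sigma> | \<sigma> permutes {1..n}. c \<sigma> * eval_word (mat_algebra s) x (Word (map \<sigma> [1..<Suc n])) $$ (a, b))"
proof -
  have E: "eval_word (mat_algebra s) x w \<in> carrier_mat s s" for w
    using x by (rule eval_word_closed)
  have "eval_poly (mat_algebra s) x f $$ (a, b)
    = (\<Sum>w\<in>Poly_Mapping.keys f. Poly_Mapping.lookup f w * eval_word (mat_algebra s) x w $$ (a, b))"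
    for f
    unfolding eval_poly_def using assms(2,3) E
    by (subst index_finsum_mat) (auto simp: module_mat_simps carrier_matD[OF E])
  then show ?thesis
    unfolding Const_mult_Var_prod by (simp only: sum_keys_sum_single finite_permutations finite_atLeastAtMost)
qed

section \<open>Weighted cycles\<close>

text \<open>
  The exponent of \<open>\<tau>\<close> in the weight of the path from position \<open>p\<close> around the cycle spelled by \<open>ls\<close>.
  Distinct (letter, position) pairs contribute distinct powers of \<open>2\<close>, so the exponent determines \<open>ls\<close>.
\<close>

definition path_exp :: "nat \<Rightarrow> nat \<Rightarrow> nat list \<Rightarrow> nat"
  where "path_exp n p ls = (\<Sum>q<length ls. 2 ^ prod_encode (ls ! q, (p + q) mod n))"

lemma path_exp_Nil [simp]: "path_exp n p [] = 0"
  by (simp add: path_exp_def)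

lemma path_exp_Cons:
  "p < n \<Longrightarrow> path_exp n p (l # ls) = 2 ^ prod_encode (l, p) + path_exp n (Suc p mod n) ls"
  by (simp add: path_exp_def sum.lessThan_Suc_shift mod_simps del: sum.lessThan_Suc)

lemma add_mod_eq_add_mod_cancel:
  fixes p q r n :: nat
  assumes "(p + q) mod n = (p + r) mod n" "q < n" "r < n"
  shows "q = r"
  using assms cong_add_lcancel_nat[of p q r n] by (simp add: cong_def)

text \<open>The exponent is the binary code of the set of (letter, position) pairs. The
  \<open>n\<close> positions are distinct residues, so this set records exactly one letter for each
  of them.\<close>

lemma path_exp_inj:
  assumes "length ls = n" "length ls' = n" "path_exp n p ls = path_exp n p ls'"
  shows "ls = ls'"
proof -
  have enc: "path_exp n p xs = set_encode ((\<lambda>q. prod_encode (xs ! q, (p + q) mod n)) ` {..<n})"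
    if "length xs = n" for xs
  proof -
    have "inj_on (\<lambda>q. prod_encode (xs ! q, (p + q) mod n)) {..<n}"
      by (auto simp: inj_on_def dest: add_mod_eq_add_mod_cancel)
    then show ?thesis
      by (simp add: path_exp_def set_encode_def sum.reindex that)
  qed
  have images: "(\<lambda>q. prod_encode (ls ! q, (p + q) mod n)) ` {..<n}
      = (\<lambda>q. prod_encode (ls' ! q, (p + q) mod n)) ` {..<n}"
    using assms by (simp add: enc set_encode_eq)
  have match: "\<exists>r<n. ls ! q = ls' ! r \<and> (p + q) mod n = (p + r) mod n" if "q < n" for q
  proof -
    have "prod_encode (ls ! q, (p + q) mod n) \<in> (\<lambda>q. prod_encode (ls' ! q, (p + q) mod n)) ` {..<n}"
      using that by (auto simp flip: images)
    then show ?thesis by auto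
  qed
  show ?thesis
  proof (rule nth_equalityI)
    show "ls ! q = ls' ! q" if "q < length ls" for q
      using match[of q] that assms(1) add_mod_eq_add_mod_cancel by blast
  qed (use assms in simp)
qed

lemma permutes_inv_pred_less:
  fixes n :: nat
  assumes "\<sigma> permutes {1..n}" "l \<in> {1..n}"
  shows "inv_into UNIV \<sigma> l - 1 < n"
proof -
  have "inv_into UNIV \<sigma> l \<in> {1..n}"
    using permutes_inv[OF assms(1)] assms(2) by (metis permutes_in_image)
  then have "1 \<le> inv_into UNIV \<sigma> l" "inv_into UNIV \<sigma> l \<le> n" by simp_all
  then show ?thesis by linarith
qed

section \<open>Matrices that step along a cycle of blocks\<close>

text \<open>The index \<open>a\<close> stands for the pair \<open>(a mod D, a div D)\<close>.\<close>

definition cycle_mat ::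
    "nat \<Rightarrow> nat \<Rightarrow> 'a::comm_ring_1 \<Rightarrow> (nat \<Rightarrow> 'a) \<Rightarrow> nat \<Rightarrow> (nat \<Rightarrow> nat \<Rightarrow> nat \<Rightarrow> 'a) \<Rightarrow> nat \<Rightarrow> 'a mat"
  where "cycle_mat D n \<tau> t l\<^sub>0 z l = mat (D * n) (D * n) (\<lambda>(a, b).
    if b div D = Suc (a div D) mod n
    then \<tau> ^ (2 ^ prod_encode (l, a div D)) *
      (if l = l\<^sub>0 then z (a mod D) (b mod D) (a div D)
       else if a mod D = b mod D then t (a mod D) else 0)
    else 0)"

lemma cycle_mat_closed [simp]: "cycle_mat D n \<tau> t l\<^sub>0 z l \<in> carrier_mat (D * n) (D * n)"
  by (simp add: cycle_mat_def)

lemma Suc_mod_add_Suc: "Suc (Suc p mod n + m) mod n = Suc (Suc (p + m)) mod n"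
  by (metis add_Suc mod_Suc_eq mod_add_left_eq)

text \<open>Meant for walks: if only one intermediate index can be passed, the sum over paths has a
  single term.\<close>

lemma index_mult_mat_single:
  assumes A: "A \<in> carrier_mat s s" and B: "B \<in> carrier_mat s s" and "a < s" "b < s" "k < s"
    and 0: "\<And>j. j < s \<Longrightarrow> j \<noteq> k \<Longrightarrow> A $$ (a, j) * B $$ (j, b) = 0"
  shows "(A * B) $$ (a, b) = A $$ (a, k) * B $$ (k, b)"
proof -
  have "(A * B) $$ (a, b) = (\<Sum>j<s. A $$ (a, j) * B $$ (j, b))"
    using assms by (simp add: scalar_prod_def atLeast0LessThan)
  also have "\<dots> = (\<Sum>j<s. if j = k then A $$ (a, k) * B $$ (k, b) else 0)"
    by (intro sum.cong) (auto simp: 0)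
  also have "\<dots> = A $$ (a, k) * B $$ (k, b)"
    using \<open>k < s\<close> by simp
  finally show ?thesis .
qed

lemma block_index_eqI:
  fixes a b D :: nat
  assumes "a mod D = b mod D" "a div D = b div D"
  shows "a = b"
  using assms by (metis div_mult_mod_eq)

lemma block_index_less:
  fixes i p D n :: nat
  assumes "i < D" "p < n"
  shows "D * p + i < D * n"
proof -
  have "D * p + i < D * Suc p" using assms by simp
  also have "\<dots> \<le> D * n" using assms(2) by (intro mult_le_mono2) simp
  finally show ?thesis .
qed

context
  fixes D n :: nat and \<tau> :: "'a::comm_ring_1" and t :: "nat \<Rightarrow> 'a" and l\<^sub>0 :: nat
    and z :: "nat \<Rightarrow> nat \<Rightarrow> nat \<Rightarrow> 'a"
  assumes D: "D > 0" and n: "n > 0"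
begin

private abbreviation "X \<equiv> cycle_mat D n \<tau> t l\<^sub>0 z"
private abbreviation "E ls \<equiv> eval_word (mat_algebra (D * n)) X (Word ls)"

private lemma E_closed: "E ls \<in> carrier_mat (D * n) (D * n)"
  by (rule eval_word_closed) simp

private lemma div_less: "a < D * n \<Longrightarrow> a div D < n"
  by (simp add: less_mult_imp_div_less mult.commute)

text \<open>A letter other than \<open>l\<^sub>0\<close> keeps the residue modulo \<open>D\<close>
  and advances the block by one, so a unique walk leaves \<open>a\<close>; the entry is its
  weight.\<close>

lemma eval_word_cycle_mat_diag:
  assumes "l\<^sub>0 \<notin> set ls" "a < D * n" "b < D * n"
  shows "E ls $$ (a, b) =
    (if a mod D = b mod D \<and> b div D = (a div D + length ls) mod n
     then t (a mod D) ^ length ls * \<tau> ^ path_exp n (a div D) ls else 0)"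
  using assms
proof (induction ls arbitrary: a)
  case Nil
  then show ?case using div_less by (auto intro: block_index_eqI)
next
  case (Cons l ls)
  let ?p = "Suc (a div D) mod n"
  let ?k = "D * ?p + a mod D"
  have k: "?k < D * n" using D n by (intro block_index_less) auto
  have "E (l # ls) $$ (a, b) = X l $$ (a, ?k) * E ls $$ (?k, b)"
    unfolding eval_word_Cons
  proof (rule index_mult_mat_single[OF cycle_mat_closed E_closed _ _ k])
    fix j assume j: "j < D * n" "j \<noteq> ?k"
    then have "j mod D \<noteq> a mod D \<or> j div D \<noteq> ?p"
      by (metis mult_div_mod_eq)
    then show "X l $$ (a, j) * E ls $$ (j, b) = 0"
      using j Cons.prems by (auto simp: cycle_mat_def)
  qed (use Cons.prems in auto)
  also have "E ls $$ (?k, b) =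
    (if a mod D = b mod D \<and> b div D = (?p + length ls) mod n
     then t (a mod D) ^ length ls * \<tau> ^ path_exp n ?p ls else 0)"
    using Cons.IH[OF _ k] Cons.prems D by simp
  also have "X l $$ (a, ?k) = \<tau> ^ (2 ^ prod_encode (l, a div D)) * t (a mod D)"
    using Cons.prems k D by (auto simp: cycle_mat_def)
  finally show ?case
    using div_less[OF Cons.prems(2)] by (simp add: path_exp_Cons power_add mod_simps mult_ac)
qed

text \<open>The residue can change only at \<open>l\<^sub>0\<close>: earlier letters contribute the
  weight of the start, later ones that of the end, and \<open>z\<close> is read at the block reached
  after \<open>us\<close>.\<close>

lemma eval_word_cycle_mat_once:
  assumes "l\<^sub>0 \<notin> set us" "l\<^sub>0 \<notin> set vs" "a < D * n" "b < D * n"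
  shows "E (us @ l\<^sub>0 # vs) $$ (a, b) =
    (if b div D = (a div D + length (us @ l\<^sub>0 # vs)) mod n
     then t (a mod D) ^ length us * t (b mod D) ^ length vs
       * z (a mod D) (b mod D) ((a div D + length us) mod n)
       * \<tau> ^ path_exp n (a div D) (us @ l\<^sub>0 # vs) else 0)"
  using assms
proof (induction us arbitrary: a)
  case Nil
  let ?p = "Suc (a div D) mod n"
  \<comment> \<open>The letters in \<open>vs\<close> preserve the residue, so
    \<open>l\<^sub>0\<close> must jump to that of \<open>b\<close> at once.\<close>
  let ?k = "D * ?p + b mod D"
  have k: "?k < D * n" using D n by (intro block_index_less) auto
  have "E (l\<^sub>0 # vs) $$ (a, b) = X l\<^sub>0 $$ (a, ?k) * E vs $$ (?k, b)"
    unfolding eval_word_Cons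
  proof (rule index_mult_mat_single[OF cycle_mat_closed E_closed _ _ k])
    fix j assume j: "j < D * n" "j \<noteq> ?k"
    then have "j mod D \<noteq> b mod D \<or> j div D \<noteq> ?p"
      by (metis mult_div_mod_eq)
    then show "X l\<^sub>0 $$ (a, j) * E vs $$ (j, b) = 0"
      using j Nil.prems by (auto simp: cycle_mat_def eval_word_cycle_mat_diag)
  qed (use Nil.prems in auto)
  also have "E vs $$ (?k, b) =
    (if b div D = (?p + length vs) mod n
     then t (b mod D) ^ length vs * \<tau> ^ path_exp n ?p vs else 0)"
    using Nil.prems D k by (simp add: eval_word_cycle_mat_diag)
  also have "X l\<^sub>0 $$ (a, ?k) = \<tau> ^ (2 ^ prod_encode (l\<^sub>0, a div D)) * z (a mod D) (b mod D) (a div D)"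
    using Nil.prems k D by (auto simp: cycle_mat_def)
  finally show ?case
    using div_less[OF Nil.prems(3)] by (simp add: path_exp_Cons power_add mod_simps mult_ac)
next
  case (Cons l us)
  let ?p = "Suc (a div D) mod n"
  let ?k = "D * ?p + a mod D"
  let ?ls = "us @ l\<^sub>0 # vs"
  have k: "?k < D * n" using D n by (intro block_index_less) auto
  have "E (l # ?ls) $$ (a, b) = X l $$ (a, ?k) * E ?ls $$ (?k, b)"
    unfolding eval_word_Cons
  proof (rule index_mult_mat_single[OF cycle_mat_closed E_closed _ _ k])
    fix j assume j: "j < D * n" "j \<noteq> ?k"
    then have "j mod D \<noteq> a mod D \<or> j div D \<noteq> ?p"
      by (metis mult_div_mod_eq)
    then show "X l $$ (a, j) * E ?ls $$ (j, b) = 0"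
      using j Cons.prems by (auto simp: cycle_mat_def)
  qed (use Cons.prems in auto)
  also have "E ?ls $$ (?k, b) =
    (if b div D = (?p + length ?ls) mod n
     then t (a mod D) ^ length us * t (b mod D) ^ length vs
       * z (a mod D) (b mod D) ((?p + length us) mod n)
       * \<tau> ^ path_exp n ?p ?ls else 0)"
    using Cons.IH[OF _ _ k] Cons.prems D by simp
  also have "X l $$ (a, ?k) = \<tau> ^ (2 ^ prod_encode (l, a div D)) * t (a mod D)"
    using Cons.prems k D by (auto simp: cycle_mat_def)
  finally show ?case
    using div_less[OF Cons.prems(3)] by (simp add: path_exp_Cons power_add mod_simps Suc_mod_add_Suc mult_ac)
qed

text \<open>A word of length \<open>n\<close> returns to its initial block. Positions in it count
  from 1, so \<open>k\<close> is the number of letters before \<open>l\<^sub>0\<close>.\<close>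

lemma eval_word_cycle_mat_permutes:
  assumes \<sigma>: "\<sigma> permutes {1..n}" and l\<^sub>0: "l\<^sub>0 \<in> {1..n}" and "a < D * n" "b < D * n"
  defines "k \<equiv> inv_into UNIV \<sigma> l\<^sub>0 - 1"
  shows "E (map \<sigma> [1..<Suc n]) $$ (a, b) =
    (if b div D = a div D
     then t (a mod D) ^ k * t (b mod D) ^ (n - 1 - k)
       * z (a mod D) (b mod D) ((a div D + k) mod n)
       * \<tau> ^ path_exp n (a div D) (map \<sigma> [1..<Suc n]) else 0)"
proof -
  let ?i = "inv_into UNIV \<sigma> l\<^sub>0"
  have i: "?i \<in> {1..n}" using permutes_inv[OF \<sigma>] l\<^sub>0 by (metis permutes_in_image)
  have \<sigma>i: "\<sigma> ?i = l\<^sub>0" using \<sigma> by (rule permutes_inverses)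
  have "[1..<Suc n] = [1..<?i] @ ?i # [Suc ?i..<Suc n]"
    using i upt_add_eq_append[of 1 ?i "Suc n - ?i"] by (simp add: upt_conv_Cons del: upt_Suc)
  then have ls: "map \<sigma> [1..<Suc n] = map \<sigma> [1..<?i] @ l\<^sub>0 # map \<sigma> [Suc ?i..<Suc n]"
    by (metis \<sigma>i list.simps(9) map_append)
  have "l\<^sub>0 \<notin> \<sigma> ` S" if "?i \<notin> S" for S
    using that \<sigma>i permutes_inj[OF \<sigma>] by (metis imageE injD)
  then have notin: "l\<^sub>0 \<notin> set (map \<sigma> [1..<?i])" "l\<^sub>0 \<notin> set (map \<sigma> [Suc ?i..<Suc n])"
    by (simp_all del: upt_Suc)
  have len: "length (map \<sigma> [1..<?i]) = k" "length (map \<sigma> [Suc ?i..<Suc n]) = n - 1 - k"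
    using i[unfolded atLeastAtMost_iff] unfolding length_map length_upt k_def by linarith+
  from eval_word_cycle_mat_once[OF notin assms(3,4)]
  show "E (map \<sigma> [1..<Suc n]) $$ (a, b) =
    (if b div D = a div D
     then t (a mod D) ^ k * t (b mod D) ^ (n - 1 - k)
       * z (a mod D) (b mod D) ((a div D + k) mod n)
       * \<tau> ^ path_exp n (a div D) (map \<sigma> [1..<Suc n]) else 0)"
    using div_less[OF assms(3)] unfolding ls[symmetric] len by (simp del: upt_Suc)
qed

end

section \<open>Generic parameters\<close>

text \<open>Cramer's rule: the adjugate divided by the determinant inverts \<open>A\<close>.\<close>

lemma solve_linear_system:
  fixes A :: "'a::field mat"
  assumes A: "A \<in> carrier_mat n n" and "det A \<noteq> 0"
  shows "\<exists>y. \<forall>p<n. (\<Sum>r<n. A $$ (p, r) * y r) = \<beta> p"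
proof -
  let ?b = "vec n \<beta>"
  define v where "v = inverse (det A) \<cdot>\<^sub>v (adj_mat A *\<^sub>v ?b)"
  have adj: "adj_mat A \<in> carrier_mat n n" using adj_mat(1)[OF A] .
  have v: "v \<in> carrier_vec n" using adj by (auto simp: v_def)
  have "A *\<^sub>v v = inverse (det A) \<cdot>\<^sub>v (A * adj_mat A *\<^sub>v ?b)"
    using A adj by (simp add: v_def mult_mat_vec assoc_mult_mat_vec[of _ n n])
  also have "\<dots> = ?b"
    using assms(2) by (intro eq_vecI) (simp_all add: adj_mat(2)[OF A] row_smult)
  finally have Av: "A *\<^sub>v v = ?b" .
  have "(\<Sum>r<n. A $$ (p, r) * v $ r) = \<beta> p" if "p < n" for p
  proof -
    have "(A *\<^sub>v v) $ p = \<beta> p" using that Av by simp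
    then show ?thesis using that A v by (simp add: scalar_prod_def atLeast0LessThan)
  qed
  then show ?thesis by blast
qed

text \<open>The parameters are chosen one by one; each new one has only finitely many values to
  avoid.\<close>

lemma exists_generic_ratios:
  fixes q :: "'a::field poly"
  assumes inf: "infinite (UNIV :: 'a set)" and "q \<noteq> 0"
  shows "\<exists>t :: nat \<Rightarrow> 'a. (\<forall>i<D. t i \<noteq> 0) \<and> (\<forall>i<D. \<forall>j<D. i \<noteq> j \<longrightarrow> poly q (t i / t j) \<noteq> 0)"
proof (induction D)
  case (Suc D)
  then obtain t :: "nat \<Rightarrow> 'a" where t: "\<And>i. i < D \<Longrightarrow> t i \<noteq> 0"
      "\<And>i j. i < D \<Longrightarrow> j < D \<Longrightarrow> i \<noteq> j \<Longrightarrow> poly q (t i / t j) \<noteq> 0"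
    by blast
  define R where "R = {r. poly q r = 0}"
  \<comment> \<open>\<open>A\<close> holds the \<open>u\<close> for which some
    \<open>u / t j\<close> is a root, \<open>B\<close> those for which some \<open>t j / u\<close>
    is. A root \<open>r = 0\<close> puts only \<open>t j / 0 = 0\<close> into \<open>B\<close>,
    which is excluded anyway.\<close>
  define A where "A = (\<lambda>(r, j). r * t j) ` (R \<times> {..<D})"
  define B where "B = (\<lambda>(r, j). t j / r) ` (R \<times> {..<D})"
  have "finite R" unfolding R_def using \<open>q \<noteq> 0\<close> by (rule poly_roots_finite)
  then have "finite ({0} \<union> A \<union> B)"
    unfolding A_def B_def by (intro finite_UnI finite_imageI finite_cartesian_product finite_lessThan) auto
  from ex_new_if_finite[OF inf this] obtain u where "u \<notin> {0} \<union> A \<union> B" ..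
  then have u: "u \<noteq> 0" "u \<notin> A" "u \<notin> B" by auto
  have 1: "poly q (u / t j) \<noteq> 0" if "j < D" for j
  proof
    assume "poly q (u / t j) = 0"
    then have "u \<in> A"
      unfolding A_def using that t(1)[OF that] by (intro image_eqI[of _ _ "(u / t j, j)"]) (auto simp: R_def)
    with u show False by blast
  qed
  have 2: "poly q (t j / u) \<noteq> 0" if "j < D" for j
  proof
    assume "poly q (t j / u) = 0"
    then have "u \<in> B"
      unfolding B_def using that t(1)[OF that] u(1)
      by (intro image_eqI[of _ _ "(t j / u, j)"]) (auto simp: R_def)
    with u show False by blast
  qed
  show ?case
    using t 1 2 u(1) by (intro exI[of _ "t(D := u)"]) (auto simp: less_Suc_eq)
qed simp

section \<open>The linear system for the free coefficients\<close>

context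
  fixes n :: nat and c :: "(nat \<Rightarrow> nat) \<Rightarrow> 'a::field" and l\<^sub>0 :: nat
begin

text \<open>A walk from block \<open>p\<close> spelled by \<open>\<sigma>\<close> meets
  \<open>l\<^sub>0\<close> at block \<open>p + letter_pos \<sigma>\<close> modulo \<open>n\<close>;
  this is the column of \<open>cycle_system\<close> to which \<open>\<sigma>\<close>
  contributes.\<close>

definition letter_pos :: "(nat \<Rightarrow> nat) \<Rightarrow> nat"
  where "letter_pos \<sigma> = inv_into UNIV \<sigma> l\<^sub>0 - 1"

definition perm_exp :: "nat \<Rightarrow> (nat \<Rightarrow> nat) \<Rightarrow> nat"
  where "perm_exp p \<sigma> = path_exp n p (map \<sigma> [1..<Suc n])"

text \<open>The variable of these polynomials stands for the ratio \<open>t\<^sub>i / t\<^sub>j\<close>.\<close>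

definition cycle_system :: "'a \<Rightarrow> 'a poly mat"
  where "cycle_system \<tau> = mat n n (\<lambda>(p, r).
    \<Sum>\<sigma> | \<sigma> permutes {1..n} \<and> (p + letter_pos \<sigma>) mod n = r.
      Polynomial.monom (c \<sigma> * \<tau> ^ perm_exp p \<sigma>) (letter_pos \<sigma>))"

lemma perm_exp_inj:
  assumes "\<sigma> permutes {1..n}" "\<sigma>' permutes {1..n}" "perm_exp p \<sigma> = perm_exp p \<sigma>'"
  shows "\<sigma> = \<sigma>'"
proof
  fix i
  have "map \<sigma> [1..<Suc n] = map \<sigma>' [1..<Suc n]"
    using assms(3) unfolding perm_exp_def by (intro path_exp_inj) auto
  then have "\<sigma> i = \<sigma>' i" if "i \<in> {1..n}"
    using that by (auto simp: map_eq_conv simp del: upt_Suc)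
  then show "\<sigma> i = \<sigma>' i"
    using assms(1,2) by (cases "i \<in> {1..n}") (auto simp: permutes_def)
qed

text \<open>It suffices that the determinant is nonzero at 0. There only permutations that start
  with \<open>l\<^sub>0\<close> survive, and they do not shift the block, so the matrix is
  diagonal.\<close>

lemma exists_det_cycle_system_nonzero:
  assumes inf: "infinite (UNIV :: 'a set)" and n: "n > 0"
    and \<sigma>\<^sub>0: "\<sigma>\<^sub>0 permutes {1..n}" "c \<sigma>\<^sub>0 \<noteq> 0" "\<sigma>\<^sub>0 1 = l\<^sub>0"
  shows "\<exists>\<tau>. det (cycle_system \<tau>) \<noteq> 0"
proof -
  let ?S = "{\<sigma>. \<sigma> permutes {1..n} \<and> letter_pos \<sigma> = 0}"
  \<comment> \<open>The diagonal entry at 0 in row \<open>p\<close>, as a polynomial in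
    \<tau>.\<close>
  define C where "C p = (\<Sum>\<sigma>\<in>?S. Polynomial.monom (c \<sigma>) (perm_exp p \<sigma>))" for p
  have fin: "finite (?S)" for p
    by (rule finite_subset[OF _ finite_permutations[of "{1..n}"]]) auto
  have "inv_into UNIV \<sigma>\<^sub>0 l\<^sub>0 = 1"
    using permutes_inverses(2)[OF \<sigma>\<^sub>0(1), of 1] \<sigma>\<^sub>0(3) by simp
  then have "\<sigma>\<^sub>0 \<in> ?S" using \<sigma>\<^sub>0(1) by (simp add: letter_pos_def)
  have "C p \<noteq> 0" for p
  proof -
    \<comment> \<open>Distinct permutations have distinct exponents, so nothing cancels the term of
      \<open>\<sigma>\<^sub>0\<close>.\<close>
    have "Polynomial.coeff (C p) (perm_exp p \<sigma>\<^sub>0) = (\<Sum>\<sigma>\<in>?S. if \<sigma> = \<sigma>\<^sub>0 then c \<sigma>\<^sub>0 else 0)"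
      unfolding C_def Polynomial.coeff_sum
      using perm_exp_inj \<sigma>\<^sub>0(1) by (intro sum.cong) (auto simp: Polynomial.coeff_monom)
    also have "\<dots> = c \<sigma>\<^sub>0" using fin \<open>\<sigma>\<^sub>0 \<in> ?S\<close> by simp
    finally show ?thesis using \<sigma>\<^sub>0(2) by auto
  qed
  then have "(\<Prod>p<n. C p) \<noteq> 0" by simp
  then obtain \<tau> where \<tau>: "poly (\<Prod>p<n. C p) \<tau> \<noteq> 0"
    using ex_new_if_finite[OF inf poly_roots_finite] by blast
  interpret at_0: comm_ring_hom "\<lambda>q :: 'a poly. poly q 0" by unfold_locales auto
  let ?A = "map_mat (\<lambda>q. poly q 0) (cycle_system \<tau>)"
  have A: "?A \<in> carrier_mat n n" by (simp add: cycle_system_def)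
  have entry: "?A $$ (p, r) = (if p = r then poly (C p) \<tau> else 0)" if "p < n" "r < n" for p r
  proof -
    have eq_iff: "(p + letter_pos \<sigma>) mod n = r \<and> letter_pos \<sigma> = 0 \<longleftrightarrow> p = r \<and> letter_pos \<sigma> = 0" for \<sigma>
      using that by (metis add_0_right mod_less)
    have "?A $$ (p, r) = (\<Sum>\<sigma> | \<sigma> permutes {1..n} \<and> (p + letter_pos \<sigma>) mod n = r.
        if letter_pos \<sigma> = 0 then c \<sigma> * \<tau> ^ perm_exp p \<sigma> else 0)"
      using that by (auto simp: cycle_system_def poly_sum poly_monom power_0_left intro!: sum.cong)
    also have "\<dots> = (\<Sum>\<sigma> | \<sigma> permutes {1..n} \<and> (p + letter_pos \<sigma>) mod n = r \<and> letter_pos \<sigma> = 0. c \<sigma> * \<tau> ^ perm_exp p \<sigma>)"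
      using finite_subset[OF _ finite_permutations[of "{1..n}"], of "{\<sigma>. \<sigma> permutes {1..n} \<and> (p + letter_pos \<sigma>) mod n = r}"]
      by (subst sum.inter_filter[symmetric]) (auto intro: sum.cong)
    also have "\<dots> = (\<Sum>\<sigma> | \<sigma> permutes {1..n} \<and> p = r \<and> letter_pos \<sigma> = 0. c \<sigma> * \<tau> ^ perm_exp p \<sigma>)"
      by (simp only: eq_iff)
    finally show ?thesis by (auto simp: C_def poly_sum poly_monom)
  qed
  have dim: "dim_row ?A = n" "dim_col ?A = n" by (simp_all add: cycle_system_def)
  have "upper_triangular ?A"
    unfolding upper_triangular_def dim
  proof (intro allI impI)
    show "?A $$ (i, j) = 0" if "i < n" "j < i" for i j
      using entry[of i j] that by (metis less_trans less_irrefl)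
  qed
  then have "det ?A = prod_list (diag_mat ?A)"
    using A by (rule det_upper_triangular)
  also have "\<dots> = (\<Prod>p<n. poly (C p) \<tau>)"
    unfolding prod_list_diag_prod dim atLeast0LessThan by (intro prod.cong) (use entry in auto)
  also have "det ?A = poly (det (cycle_system \<tau>)) 0"
    by (rule at_0.hom_det)
  finally have "poly (det (cycle_system \<tau>)) 0 \<noteq> 0"
    using \<tau> unfolding poly_prod by metis
  then have "det (cycle_system \<tau>) \<noteq> 0" by (metis poly_0)
  then show ?thesis ..
qed

end

section \<open>Trace zero matrices\<close>

text \<open>Negating the off-diagonal block inverts each unipotent factor. The product
  \<open>U * L\<close> serves as the change of basis for trace zero matrices.\<close>

lemma four_block_unipotent_inverse:
  fixes X Y :: "'a::comm_ring_1 mat"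
  assumes X: "X \<in> carrier_mat e d" and Y: "Y \<in> carrier_mat d e"
  defines "L \<equiv> four_block_mat (1\<^sub>m d) (0\<^sub>m d e) X (1\<^sub>m e)"
    and "L' \<equiv> four_block_mat (1\<^sub>m d) (0\<^sub>m d e) (- X) (1\<^sub>m e)"
    and "U \<equiv> four_block_mat (1\<^sub>m d) Y (0\<^sub>m e d) (1\<^sub>m e)"
    and "U' \<equiv> four_block_mat (1\<^sub>m d) (- Y) (0\<^sub>m e d) (1\<^sub>m e)"
  shows "(U * L) * (L' * U') = 1\<^sub>m (d + e)" "(L' * U') * (U * L) = 1\<^sub>m (d + e)"
proof -
  have carr: "L \<in> carrier_mat (d + e) (d + e)" "L' \<in> carrier_mat (d + e) (d + e)"
    "U \<in> carrier_mat (d + e) (d + e)" "U' \<in> carrier_mat (d + e) (d + e)"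
    using X Y by (auto simp: L_def L'_def U_def U'_def)
  have one: "four_block_mat (1\<^sub>m d) (0\<^sub>m d e) (0\<^sub>m e d) (1\<^sub>m e) = (1\<^sub>m (d + e) :: 'a mat)"
    by (rule eq_matI) auto
  have uminus_zero: "- 0\<^sub>m k l = (0\<^sub>m k l :: 'a mat)" for k l
    by (intro eq_matI) auto
  have uminus_X: "X + - X = 0\<^sub>m e d" "- X + X = 0\<^sub>m e d"
    and uminus_Y: "Y + - Y = 0\<^sub>m d e" "- Y + Y = 0\<^sub>m d e"
    using X Y by (auto intro!: eq_matI)
  have "L * L' = four_block_mat (1\<^sub>m d * 1\<^sub>m d + 0\<^sub>m d e * - X) (1\<^sub>m d * 0\<^sub>m d e + 0\<^sub>m d e * 1\<^sub>m e) (X * 1\<^sub>m d + 1\<^sub>m e * - X) (X * 0\<^sub>m d e + 1\<^sub>m e * 1\<^sub>m e)"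
    unfolding L_def L'_def by (rule mult_four_block_mat) (use X in auto)
  also have "\<dots> = 1\<^sub>m (d + e)"
    unfolding one[symmetric] using X by (intro cong_four_block_mat) (simp_all add: uminus_X uminus_zero)
  finally have L_inv: "L * L' = 1\<^sub>m (d + e)" .
  have "L' * L = four_block_mat (1\<^sub>m d * 1\<^sub>m d + 0\<^sub>m d e * X) (1\<^sub>m d * 0\<^sub>m d e + 0\<^sub>m d e * 1\<^sub>m e) (- X * 1\<^sub>m d + 1\<^sub>m e * X) (- X * 0\<^sub>m d e + 1\<^sub>m e * 1\<^sub>m e)"
    unfolding L_def L'_def by (rule mult_four_block_mat) (use X in auto)
  also have "\<dots> = 1\<^sub>m (d + e)"
    unfolding one[symmetric] using X by (intro cong_four_block_mat) (simp_all add: uminus_X uminus_zero)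
  finally have L_inv_left: "L' * L = 1\<^sub>m (d + e)" .
  have "U * U' = four_block_mat (1\<^sub>m d * 1\<^sub>m d + Y * 0\<^sub>m e d) (1\<^sub>m d * - Y + Y * 1\<^sub>m e) (0\<^sub>m e d * 1\<^sub>m d + 1\<^sub>m e * 0\<^sub>m e d) (0\<^sub>m e d * - Y + 1\<^sub>m e * 1\<^sub>m e)"
    unfolding U_def U'_def by (rule mult_four_block_mat) (use Y in auto)
  also have "\<dots> = 1\<^sub>m (d + e)"
    unfolding one[symmetric] using Y by (intro cong_four_block_mat) (simp_all add: uminus_Y uminus_zero)
  finally have U_inv: "U * U' = 1\<^sub>m (d + e)" .
  have "U' * U = four_block_mat (1\<^sub>m d * 1\<^sub>m d + - Y * 0\<^sub>m e d) (1\<^sub>m d * Y + - Y * 1\<^sub>m e) (0\<^sub>m e d * 1\<^sub>m d + 1\<^sub>m e * 0\<^sub>m e d) (0\<^sub>m e d * Y + 1\<^sub>m e * 1\<^sub>m e)"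
    unfolding U_def U'_def by (rule mult_four_block_mat) (use Y in auto)
  also have "\<dots> = 1\<^sub>m (d + e)"
    unfolding one[symmetric] using Y by (intro cong_four_block_mat) (simp_all add: uminus_Y uminus_zero)
  finally have U_inv_left: "U' * U = 1\<^sub>m (d + e)" .
  note assoc = assoc_mult_mat[of _ "d + e" "d + e" _ "d + e" _ "d + e"]
  have "(U * L) * (L' * U') = U * (L * L') * U'"
    using carr by (simp only: assoc mult_carrier_mat[of _ "d + e" "d + e" _ "d + e"])
  then show "(U * L) * (L' * U') = 1\<^sub>m (d + e)"
    unfolding L_inv right_mult_one_mat[OF carr(3)] U_inv .
  have "(L' * U') * (U * L) = L' * (U' * U) * L"
    using carr by (simp only: assoc mult_carrier_mat[of _ "d + e" "d + e" _ "d + e"])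
  then show "(L' * U') * (U * L) = 1\<^sub>m (d + e)"
    unfolding U_inv_left right_mult_one_mat[OF carr(2)] L_inv_left .
qed

text \<open>Powers of one generic \<open>u\<close> serve as coefficients: each combination is the
  value at \<open>u\<close> of the polynomial whose coefficients are the entries of a
  column.\<close>

lemma exists_generic_row_combination:
  fixes A :: "'a::field mat"
  assumes inf: "infinite (UNIV :: 'a set)"
  shows "\<exists>x. \<forall>j<d. (\<exists>r<d. A $$ (r, j) \<noteq> 0) \<longrightarrow> (\<Sum>r<d. x r * A $$ (r, j)) \<noteq> 0"
proof -
  let ?J = "{j. j < d \<and> (\<exists>r<d. A $$ (r, j) \<noteq> 0)}"
  define p where "p j = (\<Sum>r<d. Polynomial.monom (A $$ (r, j)) r)" for j
  have "p j \<noteq> 0" if "j \<in> ?J" for j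
  proof -
    from that obtain r where r: "r < d" "A $$ (r, j) \<noteq> 0" by blast
    have "Polynomial.coeff (p j) r = A $$ (r, j)"
      using r(1) by (simp add: p_def Polynomial.coeff_sum Polynomial.coeff_monom)
    with r(2) show ?thesis by auto
  qed
  then have "(\<Prod>j\<in>?J. p j) \<noteq> 0" by simp
  from ex_new_if_finite[OF inf poly_roots_finite[OF this]] obtain u
    where u: "poly (\<Prod>j\<in>?J. p j) u \<noteq> 0" by blast
  have "(\<Sum>r<d. u ^ r * A $$ (r, j)) \<noteq> 0" if "j \<in> ?J" for j
  proof -
    have "poly (p j) u \<noteq> 0" using u that by (auto simp: poly_prod)
    then show ?thesis by (simp add: p_def poly_sum poly_monom mult.commute)
  qed
  then show ?thesis by (intro exI[of _ "\<lambda>r. u ^ r"]) blast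
qed

text \<open>Clearing the diagonal costs one extra row and column, so \<open>B\<close> lives on the
  indices up to \<open>d\<close>.\<close>

lemma trace_zero_similar_zero_diag:
  fixes A :: "'a::field mat"
  assumes inf: "infinite (UNIV :: 'a set)" and A: "A \<in> sl d" and "d < s"
  obtains P Q B where "P \<in> carrier_mat s s" "Q \<in> carrier_mat s s"
    "P * Q = 1\<^sub>m s" "Q * P = 1\<^sub>m s"
    "B \<in> carrier_mat s s" "corner_embed d s A = Q * B * P"
    "\<And>a b. a < s \<Longrightarrow> b < s \<Longrightarrow> a = b \<or> d < a \<or> d < b \<Longrightarrow> B $$ (a, b) = 0"
proof -
  define e where "e = s - d"
  have s: "s = d + e" and "e > 0" using \<open>d < s\<close> by (auto simp: e_def)
  have Ac: "A \<in> carrier_mat d d" and tr: "(\<Sum>i<d. A $$ (i, i)) = 0"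
    using A by (auto simp: sl_def mat_trace_def)
  obtain x where x: "\<And>j. j < d \<Longrightarrow> \<exists>r<d. A $$ (r, j) \<noteq> 0 \<Longrightarrow> (\<Sum>r<d. x r * A $$ (r, j)) \<noteq> 0"
    using exists_generic_row_combination[OF inf, of d A] by blast
  define z where "z j = (\<Sum>r<d. x r * A $$ (r, j))" for j
  \<comment> \<open>If \<open>z i = 0\<close>, column \<open>i\<close> of \<open>A\<close> vanishes
    by the choice of \<open>x\<close>. Then \<open>A $$ (i, i) = 0\<close>, and division by zero
    gives the suitable value \<open>y i = 0\<close>.\<close>
  define y where "y i = - A $$ (i, i) / z i" for i
  have yz: "y i * z i = - A $$ (i, i)" if "i < d" for i
    using x[OF that] that by (cases "z i = 0") (auto simp: y_def z_def)
  \<comment> \<open>\<open>X\<close> and \<open>Y\<close> pad the row \<open>x\<close> and the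
    column \<open>y\<close> with zeros to the size of the complement.\<close>
  define X where "X = mat e d (\<lambda>(i, j). if i = 0 then x j else 0)"
  define Y where "Y = mat d e (\<lambda>(i, j). if j = 0 then y i else 0)"
  have X: "X \<in> carrier_mat e d" and Y: "Y \<in> carrier_mat d e" by (simp_all add: X_def Y_def)
  have XA: "X * A = mat e d (\<lambda>(i, j). if i = 0 then z j else 0)"
    using Ac by (intro eq_matI) (auto simp: X_def z_def scalar_prod_def atLeast0LessThan)
  have XAc: "X * A \<in> carrier_mat e d" using X Ac by simp
  have YXA: "Y * (X * A) = mat d d (\<lambda>(i, j). y i * z j)"
    unfolding XA using \<open>e > 0\<close>
    by (intro eq_matI) (auto simp: Y_def scalar_prod_def if_distrib if_distribR cong: if_cong)
  \<comment> \<open>The only entry in question is the product of \<open>z\<close> and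
    \<open>y\<close>, which is minus the trace of \<open>A\<close>.\<close>
  have XAY: "X * A * Y = 0\<^sub>m e e"
  proof (rule eq_matI)
    have "(\<Sum>j<d. z j * y j) = 0"
      using tr yz by (simp add: mult.commute[of "z _"] sum_negf)
    moreover have "(\<Sum>k<d. (if i = 0 then z k else 0) * (if j = 0 then y k else 0))
        = (if i = 0 \<and> j = 0 then \<Sum>k<d. z k * y k else 0)" for i j :: nat
      by simp
    ultimately show "(X * A * Y) $$ (i, j) = 0\<^sub>m e e $$ (i, j)"
      if "i < dim_row (0\<^sub>m e e)" "j < dim_col (0\<^sub>m e e)" for i j
      unfolding XA using that by (simp add: Y_def scalar_prod_def atLeast0LessThan)
  qed (simp_all add: X_def Y_def)
  define C where "C = A + Y * (X * A)"
  have C: "C \<in> carrier_mat d d" using Ac X Y by (simp add: C_def)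
  define L where "L = four_block_mat (1\<^sub>m d) (0\<^sub>m d e) X (1\<^sub>m e)"
  define L' where "L' = four_block_mat (1\<^sub>m d) (0\<^sub>m d e) (- X) (1\<^sub>m e)"
  define U where "U = four_block_mat (1\<^sub>m d) Y (0\<^sub>m e d) (1\<^sub>m e)"
  define U' where "U' = four_block_mat (1\<^sub>m d) (- Y) (0\<^sub>m e d) (1\<^sub>m e)"
  define S where "S = corner_embed d s A"
  define B where "B = four_block_mat C (- (C * Y)) (X * A) (0\<^sub>m e e)"
  \<comment> \<open>\<open>M\<close> is the common value of \<open>U * L * S\<close> and
    \<open>B * U * L\<close>, which shows that \<open>B\<close> is the conjugate of \<open>S\<close>
    by \<open>U * L\<close>.\<close>
  define M where "M = four_block_mat C (0\<^sub>m d e) (X * A) (0\<^sub>m e e)"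
  have carr: "L \<in> carrier_mat s s" "L' \<in> carrier_mat s s" "U \<in> carrier_mat s s" "U' \<in> carrier_mat s s"
    "S \<in> carrier_mat s s" "B \<in> carrier_mat s s" "M \<in> carrier_mat s s"
    using X Y Ac C XAc by (auto simp: L_def L'_def U_def U'_def S_def B_def M_def corner_embed_def s)
  have inv: "(U * L) * (L' * U') = 1\<^sub>m s" "(L' * U') * (U * L) = 1\<^sub>m s"
    unfolding s L_def L'_def U_def U'_def using four_block_unipotent_inverse[OF X Y] by blast+
  have LS: "L * S = four_block_mat A (0\<^sub>m d e) (X * A) (0\<^sub>m e e)"
    unfolding L_def S_def corner_embed_def e_def[symmetric] using X Ac
    by (subst mult_four_block_mat[of _ d d _ e _ e _ _ d _ e]) simp_all
  have "U * (L * S) = M"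
    unfolding LS U_def M_def C_def using X Y Ac XAc
    by (subst mult_four_block_mat[of _ d d _ e _ e _ _ d _ e]) simp_all
  moreover have "B * U = M"
    unfolding B_def U_def M_def using C Y XAc XAY uminus_l_inv_mat[of "C * Y" d e]
    by (subst mult_four_block_mat[of _ d d _ e _ e _ _ d _ e])
      (simp_all add: comm_add_mat[of _ d e] right_mult_one_mat[OF XAc])
  moreover have "M * L = M"
    unfolding M_def L_def using C X XAc
    by (subst mult_four_block_mat[of _ d d _ e _ e _ _ d _ e])
      (simp_all add: right_mult_one_mat[OF XAc] right_mult_zero_mat[OF XAc])
  moreover have "U * L * S = U * (L * S)" "B * U * L = B * (U * L)"
    using assoc_mult_mat[OF carr(3) carr(1) carr(5)] assoc_mult_mat[OF carr(6) carr(3) carr(1)] by blast+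
  ultimately have intertwine: "U * L * S = B * (U * L)" by simp
  have UL: "U * L \<in> carrier_mat s s" and LU: "L' * U' \<in> carrier_mat s s"
    by (rule mult_carrier_mat[OF carr(3) carr(1)], rule mult_carrier_mat[OF carr(2) carr(4)])
  have "S = (L' * U') * (U * L) * S"
    using carr by (simp add: inv)
  also have "\<dots> = (L' * U') * (U * L * S)"
    by (rule assoc_mult_mat[OF LU UL carr(5)])
  also have "\<dots> = (L' * U') * B * (U * L)"
    unfolding intertwine by (rule assoc_mult_mat[OF LU carr(6) UL, symmetric])
  finally have S: "S = (L' * U') * B * (U * L)" .
  have diag: "C $$ (i, i) = 0" if "i < d" for i
    using that yz[of i] Ac by (simp add: C_def YXA)
  have CY: "row C i \<bullet> col Y j = 0" if "i < d" "0 < j" "j < e" for i j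
    using that C by (simp add: Y_def scalar_prod_def)
  have "B $$ (a, b) = 0" if ab: "a < s" "b < s" "a = b \<or> d < a \<or> d < b" for a b
  proof -
    have B_index: "B $$ (a, b) =
      (if a < d then if b < d then C $$ (a, b) else (- (C * Y)) $$ (a, b - d)
       else if b < d then (X * A) $$ (a - d, b) else 0)"
      using ab C by (simp add: B_def s)
    consider "a < d" "b < d" | "a < d" "\<not> b < d" | "\<not> a < d" "b < d" | "\<not> a < d" "\<not> b < d"
      by blast
    then show ?thesis
    proof cases
      case 1
      with ab show ?thesis unfolding B_index by (simp add: diag)
    next
      case 2
      with ab C Y show ?thesis unfolding B_index by (simp add: CY s)
    next
      case 3
      with ab show ?thesis unfolding B_index by (simp add: XA s)
    next
      case 4
      then show ?thesis unfolding B_index by simp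
    qed
  qed
  from that[OF UL LU inv carr(6) S[unfolded S_def] this] show thesis .
qed

section \<open>The image of a multilinear polynomial\<close>

text \<open>For \<open>i \<noteq> j\<close> the entries from \<open>(i, p)\<close> to
  \<open>(j, p)\<close> involve only the coefficients \<open>z i j\<close>, so the problem splits
  into one system of size \<open>n\<close> for each pair.\<close>

lemma zero_block_diagonal_in_image:
  fixes c :: "(nat \<Rightarrow> nat) \<Rightarrow> 'a::field"
  assumes inf: "infinite (UNIV :: 'a set)" and n: "n > 0" and D: "D > 0"
    and \<sigma>\<^sub>0: "\<sigma>\<^sub>0 permutes {1..n}" "c \<sigma>\<^sub>0 \<noteq> 0"
    and B: "B \<in> carrier_mat (D * n) (D * n)"
    and B0: "\<And>a b. a < D * n \<Longrightarrow> b < D * n \<Longrightarrow> a div D \<noteq> b div D \<or> a mod D = b mod D \<Longrightarrow> B $$ (a, b) = 0"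
  shows "\<exists>x. (\<forall>l. x l \<in> carrier_mat (D * n) (D * n)) \<and> eval_poly (mat_algebra (D * n)) x
    (\<Sum>\<sigma> | \<sigma> permutes {1..n}. Const (c \<sigma>) * (\<Prod>i\<leftarrow>[1..<Suc n]. Var (\<sigma> i))) = B"
proof -
  define l\<^sub>0 where "l\<^sub>0 = \<sigma>\<^sub>0 1"
  have l\<^sub>0: "l\<^sub>0 \<in> {1..n}"
    using permutes_in_image[OF \<sigma>\<^sub>0(1), of 1] n by (simp add: l\<^sub>0_def)
  let ?pos = "letter_pos l\<^sub>0" and ?S = "{\<sigma>. \<sigma> permutes {1..n}}"
  have pos_less: "?pos \<sigma> < n" if "\<sigma> permutes {1..n}" for \<sigma>
    unfolding letter_pos_def using that l\<^sub>0 by (rule permutes_inv_pred_less)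
  obtain \<tau> where "det (cycle_system n c l\<^sub>0 \<tau>) \<noteq> 0"
    using exists_det_cycle_system_nonzero[where c = c, OF inf n \<sigma>\<^sub>0 l\<^sub>0_def[symmetric]] by blast
  from exists_generic_ratios[OF inf this, of D] obtain t where
    t0: "\<And>i. i < D \<Longrightarrow> t i \<noteq> 0" and
    t: "\<And>i j. i < D \<Longrightarrow> j < D \<Longrightarrow> i \<noteq> j \<Longrightarrow> poly (det (cycle_system n c l\<^sub>0 \<tau>)) (t i / t j) \<noteq> 0"
    by blast
  define N where "N i j = map_mat (\<lambda>q. poly q (t i / t j)) (cycle_system n c l\<^sub>0 \<tau>)" for i j
  have N: "N i j \<in> carrier_mat n n" for i j
    by (simp add: N_def cycle_system_def)
  \<comment> \<open>The right-hand side is divided by \<open>t j ^ (n - 1)\<close> because the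
    \<open>n - 1\<close> letters other than \<open>l\<^sub>0\<close> contribute
    \<open>t j ^ (n - 1)\<close> times a power of \<open>t i / t j\<close>.\<close>
  have "\<exists>y. i < D \<longrightarrow> j < D \<longrightarrow> i \<noteq> j \<longrightarrow>
      (\<forall>p<n. (\<Sum>r<n. N i j $$ (p, r) * y r) = B $$ (D * p + i, D * p + j) / t j ^ (n - 1))" for i j
  proof (cases "i < D \<and> j < D \<and> i \<noteq> j")
    case True
    interpret at: comm_ring_hom "\<lambda>q :: 'a poly. poly q (t i / t j)" by unfold_locales auto
    have "det (N i j) \<noteq> 0" using t True unfolding N_def at.hom_det by blast
    from solve_linear_system[OF N this, of "\<lambda>p. B $$ (D * p + i, D * p + j) / t j ^ (n - 1)"]
    show ?thesis by (elim exE) (intro exI impI)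
  qed auto
  then obtain y where y: "\<And>i j p. i < D \<Longrightarrow> j < D \<Longrightarrow> i \<noteq> j \<Longrightarrow> p < n \<Longrightarrow>
      (\<Sum>r<n. N i j $$ (p, r) * y i j r) = B $$ (D * p + i, D * p + j) / t j ^ (n - 1)"
    by metis
  \<comment> \<open>The ratio 1 need not be generic, but for \<open>i = j\<close> the required
    entries are zero and zero coefficients yield them.\<close>
  define z where "z i j = (if i = j then (\<lambda>_. 0) else y i j)" for i j
  define x where "x = cycle_mat D n \<tau> t l\<^sub>0 z"
  have x: "x l \<in> carrier_mat (D * n) (D * n)" for l by (simp add: x_def)
  define f where "f = (\<Sum>\<sigma> | \<sigma> permutes {1..n}. Const (c \<sigma>) * (\<Prod>i\<leftarrow>[1..<Suc n]. Var (\<sigma> i)))"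
  have entry: "eval_poly (mat_algebra (D * n)) x f $$ (a, b) = B $$ (a, b)"
    if ab: "a < D * n" "b < D * n" for a b
  proof -
    define i where "i = a mod D"
    define j where "j = b mod D"
    define p where "p = a div D"
    have ij: "i < D" "j < D" using D by (simp_all add: i_def j_def)
    have p: "p < n" using ab(1) by (simp add: p_def less_mult_imp_div_less mult.commute)
    have word: "eval_word (mat_algebra (D * n)) x (Word (map \<sigma> [1..<Suc n])) $$ (a, b) =
        (if b div D = p
         then t i ^ ?pos \<sigma> * t j ^ (n - 1 - ?pos \<sigma>) * z i j ((p + ?pos \<sigma>) mod n) * \<tau> ^ perm_exp n p \<sigma>
         else 0)" if "\<sigma> permutes {1..n}" for \<sigma>
      unfolding x_def i_def j_def p_def letter_pos_def perm_exp_def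
      by (rule eval_word_cycle_mat_permutes[OF D n that l\<^sub>0 ab])
    have "eval_poly (mat_algebra (D * n)) x f $$ (a, b)
      = (\<Sum>\<sigma>\<in>?S. c \<sigma> * eval_word (mat_algebra (D * n)) x (Word (map \<sigma> [1..<Suc n])) $$ (a, b))"
      unfolding f_def by (rule index_eval_multilinear[OF x ab])
    also have "\<dots> = (\<Sum>\<sigma>\<in>?S. c \<sigma> * (if b div D = p
          then t i ^ ?pos \<sigma> * t j ^ (n - 1 - ?pos \<sigma>) * z i j ((p + ?pos \<sigma>) mod n) * \<tau> ^ perm_exp n p \<sigma>
          else 0))"
    proof (rule sum.cong[OF refl])
      fix \<sigma> assume "\<sigma> \<in> ?S"
      then have "\<sigma> permutes {1..n}" ..
      from word[OF this] show "c \<sigma> * eval_word (mat_algebra (D * n)) x (Word (map \<sigma> [1..<Suc n])) $$ (a, b)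
        = c \<sigma> * (if b div D = p
          then t i ^ ?pos \<sigma> * t j ^ (n - 1 - ?pos \<sigma>) * z i j ((p + ?pos \<sigma>) mod n) * \<tau> ^ perm_exp n p \<sigma>
          else 0)" by (rule arg_cong)
    qed
    also have "\<dots> = B $$ (a, b)"
    proof (cases "b div D = p \<and> i \<noteq> j")
      case False
      then have "B $$ (a, b) = 0"
        using B0[OF ab] unfolding i_def j_def p_def by metis
      with False show ?thesis by (cases "b div D = p") (auto simp: z_def)
    next
      case True
      define h where "h \<sigma> = c \<sigma> * \<tau> ^ perm_exp n p \<sigma> * (t i / t j) ^ ?pos \<sigma> * z i j ((p + ?pos \<sigma>) mod n)" for \<sigma>
      have pw: "t i ^ k * t j ^ (n - 1 - k) = t j ^ (n - 1) * (t i / t j) ^ k" if "k < n" for k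
        using that t0[OF ij(2)] by (simp add: power_divide power_diff)
      have "(\<Sum>\<sigma>\<in>?S. c \<sigma> * (if b div D = p
          then t i ^ ?pos \<sigma> * t j ^ (n - 1 - ?pos \<sigma>) * z i j ((p + ?pos \<sigma>) mod n) * \<tau> ^ perm_exp n p \<sigma>
          else 0)) = (\<Sum>\<sigma>\<in>?S. t j ^ (n - 1) * h \<sigma>)"
      proof (rule sum.cong[OF refl])
        fix \<sigma> assume "\<sigma> \<in> ?S"
        then have pos: "?pos \<sigma> < n" by (intro pos_less) simp
        show "c \<sigma> * (if b div D = p
          then t i ^ ?pos \<sigma> * t j ^ (n - 1 - ?pos \<sigma>) * z i j ((p + ?pos \<sigma>) mod n) * \<tau> ^ perm_exp n p \<sigma>
          else 0) = t j ^ (n - 1) * h \<sigma>"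
          unfolding if_P[OF conjunct1[OF True]] pw[OF pos] h_def by (simp only: mult_ac)
      qed
      also have "\<dots> = t j ^ (n - 1) * (\<Sum>\<sigma>\<in>?S. h \<sigma>)"
        by (simp only: sum_distrib_left)
      \<comment> \<open>Grouping by the block \<open>r\<close> at which \<open>l\<^sub>0\<close> is
        used collects the coefficient of the unknown \<open>y i j r\<close>.\<close>
      also have "(\<Sum>\<sigma>\<in>?S. h \<sigma>) = (\<Sum>r<n. \<Sum>\<sigma> | \<sigma> \<in> ?S \<and> (p + ?pos \<sigma>) mod n = r. h \<sigma>)"
      proof (rule sum.group[symmetric])
        show "(\<lambda>\<sigma>. (p + ?pos \<sigma>) mod n) ` ?S \<subseteq> {..<n}" using n by auto
      qed (simp_all add: finite_permutations)
      also have "(\<Sum>r<n. \<Sum>\<sigma> | \<sigma> \<in> ?S \<and> (p + ?pos \<sigma>) mod n = r. h \<sigma>) = (\<Sum>r<n. N i j $$ (p, r) * y i j r)"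
      proof (intro sum.cong refl)
        fix r assume "r \<in> {..<n}"
        then have "N i j $$ (p, r) = (\<Sum>\<sigma> | \<sigma> \<in> ?S \<and> (p + ?pos \<sigma>) mod n = r.
            c \<sigma> * \<tau> ^ perm_exp n p \<sigma> * (t i / t j) ^ ?pos \<sigma>)"
          using p by (simp add: N_def cycle_system_def poly_sum poly_monom)
        then show "(\<Sum>\<sigma> | \<sigma> \<in> ?S \<and> (p + ?pos \<sigma>) mod n = r. h \<sigma>) = N i j $$ (p, r) * y i j r"
          using True by (auto simp: h_def z_def sum_distrib_right intro!: sum.cong)
      qed
      also have "\<dots> = B $$ (D * p + i, D * p + j) / t j ^ (n - 1)"
        using y ij p True by blast
      also have "D * p + i = a" by (simp add: p_def i_def)
      also have "D * p + j = b" using True by (simp add: j_def) (metis mult_div_mod_eq)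
      finally show ?thesis using t0[OF ij(2)] by simp
    qed
    finally show ?thesis .
  qed
  have "eval_poly (mat_algebra (D * n)) x f = B"
  proof (rule eq_matI)
    have "eval_poly (mat_algebra (D * n)) x f \<in> carrier_mat (D * n) (D * n)"
      using x by (rule eval_poly_closed)
    then show "dim_row (eval_poly (mat_algebra (D * n)) x f) = dim_row B"
      "dim_col (eval_poly (mat_algebra (D * n)) x f) = dim_col B"
      using B by auto
  next
    fix a b assume "a < dim_row B" "b < dim_col B"
    then show "eval_poly (mat_algebra (D * n)) x f $$ (a, b) = B $$ (a, b)"
      using B by (intro entry) simp_all
  qed
  with x show ?thesis unfolding f_def by blast
qed

theorem theorem1p1:
  fixes f :: "'a::field free_poly" and d n :: nat
  assumes "infinite (UNIV :: 'a set)"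
    and "d \<ge> 1"
    and "n \<ge> 1"
    and "f \<in> free_algebra n"
    and "multilinear n f"
    and "f \<noteq> 0"
  shows "\<exists>s. s \<ge> d \<and> corner_embed d s ` sl d \<subseteq> poly_image n f (mat_algebra s)"
proof -
  obtain c where c: "f = (\<Sum>\<sigma> | \<sigma> permutes {1..n}. Const (c \<sigma>) * (\<Prod>i\<leftarrow>[1..<Suc n]. Var (\<sigma> i)))"
    using assms(5) unfolding multilinear_def by blast
  obtain \<sigma>\<^sub>0 where \<sigma>\<^sub>0: "\<sigma>\<^sub>0 permutes {1..n}" "c \<sigma>\<^sub>0 \<noteq> 0"
  proof (rule ccontr)
    assume "\<not> thesis"
    with that have "c \<sigma> = 0" if "\<sigma> permutes {1..n}" for \<sigma>
      using \<open>\<sigma> permutes _\<close> by blast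
    then have "f = 0"
      unfolding c Const_mult_Var_prod by (intro sum.neutral) (simp del: upt_Suc)
    with assms(6) show False ..
  qed
  \<comment> \<open>One more than \<open>d\<close>, so that the extra row and column of
    \<open>B\<close> fit into the first block.\<close>
  define D where "D = Suc d"
  define s where "s = D * n"
  have "d < D" "D \<le> s" using mult_le_mono2[OF assms(3), of D] by (simp_all add: D_def s_def)
  then have "d < s" by simp
  have "corner_embed d s A \<in> poly_image n f (mat_algebra s)" if A: "A \<in> sl d" for A
  proof -
    obtain P Q B where
      PQ: "P \<in> carrier_mat s s" "Q \<in> carrier_mat s s" "P * Q = 1\<^sub>m s" "Q * P = 1\<^sub>m s" and
      B: "B \<in> carrier_mat s s" "corner_embed d s A = Q * B * P" and
      B0: "\<And>a b. a < s \<Longrightarrow> b < s \<Longrightarrow> a = b \<or> d < a \<or> d < b \<Longrightarrow> B $$ (a, b) = 0"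
      by (rule trace_zero_similar_zero_diag[OF assms(1) A \<open>d < s\<close>]) (rule that; blast)
    \<comment> \<open>Indices below \<open>D\<close> have quotient 0 and are their own residues, so
      within the first block only the zero diagonal of \<open>B\<close> matters.\<close>
    have "B $$ (a, b) = 0" if "a < s" "b < s" "a div D \<noteq> b div D \<or> a mod D = b mod D" for a b
    proof (cases "d < a \<or> d < b")
      case False
      then have "a < D" "b < D" by (auto simp: D_def)
      with that show ?thesis by (intro B0) auto
    qed (use B0 that in blast)
    then have "\<exists>x. (\<forall>l. x l \<in> carrier_mat s s) \<and> eval_poly (mat_algebra s) x f = B"
      unfolding c s_def using assms(1,3) \<sigma>\<^sub>0 B(1)
      by (intro zero_block_diagonal_in_image[where c = c and \<sigma>\<^sub>0 = \<sigma>\<^sub>0]) (simp_all add: D_def s_def)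
    then obtain x where x: "\<And>l. x l \<in> carrier_mat s s" "eval_poly (mat_algebra s) x f = B"
      by blast
    have "corner_embed d s A = eval_poly (mat_algebra s) (\<lambda>l. Q * x l * P) f"
      unfolding eval_poly_conj[OF x(1) PQ] x(2) B(2) ..
    moreover have "Q * x l * P \<in> carrier (mat_algebra s)" for l
      using PQ x(1)[of l] by (simp add: module_mat_simps)
    ultimately show ?thesis
      unfolding poly_image_def by (intro CollectI exI[of _ "\<lambda>l. Q * x l * P"] conjI ballI)
  qed
  with \<open>d < s\<close> show ?thesis by (intro exI[of _ s]) auto
qed

end
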